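(* Let $G_1,G_2$ be linear time-invariant systems $$G_i:\quad \begin{pmatrix}\dot x_i\\ w_i\\ z_i\end{pmatrix}=\begin{pmatrix}A_i&B_i&E_i\\ C_i&D_i&0\\ F_i&K_i&L_i\end{pmatrix}\begin{pmatrix}x_i\\ v_i\\ d_i\end{pmatrix},\qquad i=1,2,$$ with real matrices $A_i\in\mathbb{R}^{n_i\times n_i}$, $D_i\in\mathbb{R}^{n_{wi}\times n_{vi}}$, $L_i\in\mathbb{R}^{n_{zi}\times n_{di}}$ (other blocks of compatible size), where $n_{v1}=n_{w2}$ and $n_{v2}=n_{w1}$. Let $G$ be the system with input $(d_1,d_2)$ and output $(z_1,z_2)$ obtained by imposing $v_1=w_2$, $v_2=w_1$. Assume that $C_1$ and $C_2$ have full row rank and that $G$ is well-posed. Suppose that $G$ is strictly dissipative with respect to a quadratic supply function of the additive form $$s_{ext}(d_1,d_2,z_1,z_2)=s_{1,ext}(d_1,z_1)+s_{2,ext}(d_2,z_2),$$ with a storage function of the additive form $V(x_1,x_2)=V_1(x_1)+V_2(x_2)$, where $V_1,V_2$ are quadratic functions. Then there exist quadratic functions $s_{1,int}(v_1,w_1)$ and $s_{2,int}(v_2,w_2)$ such that $$s_{1,int}(v_1,w_1)+s_{2,int}(v_2,w_2)=0\quad\text{whenever } v_1=w_2,\ v_2=w_1,$$ and (i) $G_1$ (with input $(v_1,d_1)$ and output $(w_1,z_1)$) is strictly dissipative with respect to the supply function $s_{1,ext}(d_1,z_1)+s_{1,int}(v_1,w_1)$ with the storage function $V_1(x_1)$;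 (ii) $G_2$ (with input $(v_2,d_2)$ and output $(w_2,z_2)$) is strictly dissipative with respect to the supply function $s_{2,ext}(d_2,z_2)+s_{2,int}(v_2,w_2)$ with the storage function $V_2(x_2)$.
   Context: All matrices are real. "Quadratic function" means a quadratic form: a quadratic supply function of input $d$ and output $z$ is $s(d,z)=\begin{pmatrix} d \\ z \end{pmatrix}^\top\begin{pmatrix} Q & S \\ S^\top & R \end{pmatrix}\begin{pmatrix} d \\ z \end{pmatrix}$ with $Q,R$ symmetric, and a quadratic storage function is $V(x)=x^\top Px$ with $P$ symmetric (not required to be positive definite or semidefinite). A linear system $\dot x=Ax+Bd$, $z=Cx+Dd$ is strictly dissipative with respect to a quadratic supply function $s(d,z)$ with storage function $V(x)=x^\top Px$ if $2x^\top P(Ax+Bd)<s(d,\,Cx+Dd)$ for all $(x,d)\neq 0$. The interconnection is well-posed if the constraints $v_1=w_2$, $v_2=w_1$ determine $v_1,v_2$ uniquely from $x_1,x_2$, i.e. $I-D_2D_1$ is invertible. $G$ is then a linear system with state $(x_1,x_2)$, input $(d_1,d_2)$ and output $(z_1,z_2)$. *)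

theory Defs
  imports "HOL-Analysis.Analysis"
begin

text \<open>Dimensions are finite index types. Stacked vectors and block matrices are indexed by
  sum types.\<close>

definition stack :: "'a^'m::finite \<Rightarrow> 'a^'n::finite \<Rightarrow> 'a^('m + 'n)" where
  "stack x y = (\<chi> i. case i of Inl j \<Rightarrow> x $ j | Inr j \<Rightarrow> y $ j)"

definition upper :: "'a^('m::finite + 'n::finite) \<Rightarrow> 'a^'m" where
  "upper x = (\<chi> i. x $ Inl i)"

definition lower :: "'a^('m::finite + 'n::finite) \<Rightarrow> 'a^'n" where
  "lower x = (\<chi> i. x $ Inr i)"

definition hblock :: "'a^'m::finite^'k \<Rightarrow> 'a^'n::finite^'k \<Rightarrow> 'a^('m + 'n)^'k" where
  "hblock A B = (\<chi> i. stack (A $ i) (B $ i))"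

definition block :: "'a^'m::finite^'k::finite \<Rightarrow> 'a^'n::finite^'k \<Rightarrow> 'a^'m^'l::finite \<Rightarrow> 'a^'n^'l \<Rightarrow> 'a^('m + 'n)^('k + 'l)" where
  "block A B C D = stack (hblock A B) (hblock C D)"

definition quadratic_storage :: "(real^'n \<Rightarrow> real) \<Rightarrow> bool" where
  "quadratic_storage V \<longleftrightarrow>
     (\<exists>P :: real^'n^'n. transpose P = P \<and> V = (\<lambda>x. x \<bullet> (P *v x)))"

definition quadratic_supply :: "(real^'d \<Rightarrow> real^'z \<Rightarrow> real) \<Rightarrow> bool" where
  "quadratic_supply s \<longleftrightarrow>
     (\<exists>(Q :: real^'d^'d) (S :: real^'z^'d) (R :: real^'z^'z).
        transpose Q = Q \<and> transpose R = R \<and>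
        s = (\<lambda>d z. stack d z \<bullet> (block Q S (transpose S) R *v stack d z)))"

record ('n, 'd, 'z) lti =
  sysA :: "real^'n^'n"
  sysB :: "real^'d^'n"
  sysC :: "real^'n^'z"
  sysD :: "real^'d^'z"

text \<open>The symmetric matrix \<open>P\<close> below is uniquely determined by \<open>V\<close>.\<close>

definition strictly_dissipative ::
  "('n::finite, 'd::finite, 'z::finite) lti \<Rightarrow> (real^'d \<Rightarrow> real^'z \<Rightarrow> real) \<Rightarrow> (real^'n \<Rightarrow> real) \<Rightarrow> bool"
  where
  "strictly_dissipative G s V \<longleftrightarrow> quadratic_supply s \<and>
     (\<exists>P :: real^'n^'n. transpose P = P \<and> V = (\<lambda>x. x \<bullet> (P *v x)) \<and>
        (\<forall>x d. (x, d) \<noteq> (0, 0) \<longrightarrow>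
           2 * (x \<bullet> (P *v (sysA G *v x + sysB G *v d))) < s d (sysC G *v x + sysD G *v d)))"

text \<open>A system with interconnection input \<open>v\<close> and output \<open>w\<close>, and external input \<open>d\<close> and
  output \<open>z\<close>; there is no feedthrough from \<open>d\<close> to \<open>w\<close>.\<close>

record ('n, 'v, 'w, 'd, 'z) subsystem =
  matA :: "real^'n^'n"
  matB :: "real^'v^'n"
  matE :: "real^'d^'n"
  matC :: "real^'n^'w"
  matD :: "real^'v^'w"
  matF :: "real^'n^'z"
  matK :: "real^'v^'z"
  matL :: "real^'d^'z"

definition open_loop ::
  "('n::finite, 'v::finite, 'w::finite, 'd::finite, 'z::finite) subsystem \<Rightarrow> ('n, 'v + 'd, 'w + 'z) lti" where
  "open_loop G =
     \<lparr> sysA = matA G,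
       sysB = hblock (matB G) (matE G),
       sysC = stack (matC G) (matF G),
       sysD = block (matD G) 0 (matK G) (matL G) \<rparr>"

definition well_posed ::
  "('n1::finite, 'p::finite, 'q::finite, 'd1::finite, 'z1::finite) subsystem
   \<Rightarrow> ('n2::finite, 'q, 'p, 'd2::finite, 'z2::finite) subsystem \<Rightarrow> bool" where
  "well_posed G1 G2 \<longleftrightarrow>
     (\<forall>x1 x2. \<exists>!(v1, v2). v1 = matC G2 *v x2 + matD G2 *v v2 \<and> v2 = matC G1 *v x1 + matD G1 *v v1)"

text \<open>Solving \<open>v1 = w2\<close>, \<open>v2 = w1\<close> gives
  \<open>v1 = M (D2 C1 x1 + C2 x2)\<close> and \<open>v2 = C1 x1 + D1 v1\<close> with \<open>M = (I - D2 D1)\<^sup>-\<^sup>1\<close>;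
  \<open>Vij\<close> is the matrix from \<open>xj\<close> to \<open>vi\<close>. The lemma \<open>interconnection_correct\<close> confirms that this
  is the system obtained by imposing the interconnection constraints.\<close>

definition interconnection ::
  "('n1::finite, 'p::finite, 'q::finite, 'd1::finite, 'z1::finite) subsystem
   \<Rightarrow> ('n2::finite, 'q, 'p, 'd2::finite, 'z2::finite) subsystem
   \<Rightarrow> ('n1 + 'n2, 'd1 + 'd2, 'z1 + 'z2) lti" where
  "interconnection G1 G2 =
    (let M = matrix_inv (mat 1 - matD G2 ** matD G1);
         V11 = M ** matD G2 ** matC G1;
         V12 = M ** matC G2;
         V21 = matC G1 + matD G1 ** V11;
         V22 = matD G1 ** V12
     in \<lparr> sysA = block (matA G1 + matB G1 ** V11) (matB G1 ** V12)
                       (matB G2 ** V21) (matA G2 + matB G2 ** V22),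
          sysB = block (matE G1) 0 0 (matE G2),
          sysC = block (matF G1 + matK G1 ** V11) (matK G1 ** V12)
                       (matK G2 ** V21) (matF G2 + matK G2 ** V22),
          sysD = block (matL G1) 0 0 (matL G2) \<rparr>)"

lemma stack_add: "stack x y + stack x' y' = stack (x + x') (y + y')"
  by (auto simp: stack_def vec_eq_iff split: sum.split)

lemma upper_stack [simp]: "upper (stack x y) = x"
  and lower_stack [simp]: "lower (stack x y) = y"
  and stack_upper_lower [simp]: "stack (upper u) (lower u) = u"
  by (auto simp: stack_def upper_def lower_def vec_eq_iff split: sum.split)

lemma sum_UNIV_Plus:
  fixes f :: "'m::finite + 'n::finite \<Rightarrow> real"
  shows "(\<Sum>i\<in>UNIV. f i) = (\<Sum>i\<in>UNIV. f (Inl i)) + (\<Sum>i\<in>UNIV. f (Inr i))"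
  by (subst UNIV_Plus_UNIV [symmetric], subst sum.Plus) auto

lemma hblock_mult_stack:
  fixes A :: "real^'m^'k" and B :: "real^'n^'k"
  shows "hblock A B *v stack x y = A *v x + B *v y"
  by (simp add: vec_eq_iff hblock_def stack_def matrix_vector_mult_def sum_UNIV_Plus)

lemma stack_mult:
  fixes A :: "real^'m^'k" and B :: "real^'m^'l"
  shows "stack A B *v x = stack (A *v x) (B *v x)"
  by (auto simp: vec_eq_iff stack_def matrix_vector_mult_def split: sum.split)

lemma block_mult_stack:
  fixes A :: "real^'m^'k" and B :: "real^'n^'k" and C :: "real^'m^'l" and D :: "real^'n^'l"
  shows "block A B C D *v stack x y = stack (A *v x + B *v y) (C *v x + D *v y)"
  by (simp add: block_def stack_mult hblock_mult_stack)

lemma well_posed_iff_invertible: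
  fixes G1 :: "('n1::finite, 'p::finite, 'q::finite, 'd1::finite, 'z1::finite) subsystem"
    and G2 :: "('n2::finite, 'q, 'p, 'd2::finite, 'z2::finite) subsystem"
  shows "well_posed G1 G2 \<longleftrightarrow> invertible (mat 1 - matD G2 ** matD G1)"
proof
  assume wp: "well_posed G1 G2"
  have "v = 0" if v: "(mat 1 - matD G2 ** matD G1) *v v = 0" for v
  proof -
    have "\<exists>!(v1, v2). v1 = matD G2 *v v2 \<and> v2 = matD G1 *v v1"
      using wp [unfolded well_posed_def, rule_format, of 0 0] by simp
    then obtain p where p: "q = p" if "case q of (v1, v2) \<Rightarrow> v1 = matD G2 *v v2 \<and> v2 = matD G1 *v v1" for q
      by (elim ex1E) blast
    have "v = matD G2 *v (matD G1 *v v)"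
      using v by (simp add: matrix_vector_mult_diff_rdistrib matrix_vector_mul_assoc)
    then have "(v, matD G1 *v v) = p"
      by (intro p) (simp only: prod.case simp_thms)
    moreover have "(0, 0) = p"
      by (intro p) simp
    ultimately show ?thesis
      by (metis prod.inject)
  qed
  then show "invertible (mat 1 - matD G2 ** matD G1)"
    by (metis invertible_left_inverse matrix_left_invertible_ker)
next
  assume "invertible (mat 1 - matD G2 ** matD G1)"
  then obtain M where M: "M ** (mat 1 - matD G2 ** matD G1) = mat 1"
      "(mat 1 - matD G2 ** matD G1) ** M = mat 1"
    unfolding invertible_def by blast
  show "well_posed G1 G2"
    unfolding well_posed_def
  proof (intro allI)
    fix x1 x2
    let ?r = "matC G2 *v x2 + matD G2 *v (matC G1 *v x1)"
    have eq: "v1 = matC G2 *v x2 + matD G2 *v (matC G1 *v x1 + matD G1 *v v1) \<longleftrightarrow> v1 = M *v ?r" for v1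
    proof -
      have "v1 = matC G2 *v x2 + matD G2 *v (matC G1 *v x1 + matD G1 *v v1) \<longleftrightarrow>
          (mat 1 - matD G2 ** matD G1) *v v1 = ?r"
        by (simp add: matrix_vector_mult_diff_rdistrib matrix_vector_mul_assoc [symmetric]
            matrix_vector_right_distrib diff_eq_eq add.assoc)
      also have "\<dots> \<longleftrightarrow> v1 = M *v ?r"
      proof
        assume "(mat 1 - matD G2 ** matD G1) *v v1 = ?r"
        then have "M *v ?r = (M ** (mat 1 - matD G2 ** matD G1)) *v v1"
          by (simp only: matrix_vector_mul_assoc [symmetric])
        then show "v1 = M *v ?r"
          by (simp only: M matrix_vector_mul_lid)
      next
        assume "v1 = M *v ?r"
        then show "(mat 1 - matD G2 ** matD G1) *v v1 = ?r"
          by (simp only: M matrix_vector_mul_assoc matrix_vector_mul_lid)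
      qed
      finally show ?thesis .
    qed
    show "\<exists>!(v1, v2). v1 = matC G2 *v x2 + matD G2 *v v2 \<and> v2 = matC G1 *v x1 + matD G1 *v v1"
    proof (rule ex1I [of _ "(M *v ?r, matC G1 *v x1 + matD G1 *v (M *v ?r))"])
      show "case (M *v ?r, matC G1 *v x1 + matD G1 *v (M *v ?r)) of (v1, v2) \<Rightarrow>
          v1 = matC G2 *v x2 + matD G2 *v v2 \<and> v2 = matC G1 *v x1 + matD G1 *v v1"
        unfolding prod.case using eq [of "M *v ?r"] by blast
    next
      fix u
      assume u: "case u of (v1, v2) \<Rightarrow>
          v1 = matC G2 *v x2 + matD G2 *v v2 \<and> v2 = matC G1 *v x1 + matD G1 *v v1"
      obtain u1 u2 where "u = (u1, u2)"
        by (cases u)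
      from u have u1: "u1 = matC G2 *v x2 + matD G2 *v u2" and u2: "u2 = matC G1 *v x1 + matD G1 *v u1"
        unfolding \<open>u = (u1, u2)\<close> prod.case by blast+
      have "u1 = M *v ?r"
        using u1 unfolding u2 by (rule eq [THEN iffD1])
      then show "u = (M *v ?r, matC G1 *v x1 + matD G1 *v (M *v ?r))"
        using u2 by (simp only: \<open>u = (u1, u2)\<close>)
    qed
  qed
qed

lemma interconnection_correct:
  assumes "well_posed G1 G2"
    and w1: "w1 = matC G1 *v x1 + matD G1 *v v1" and w2: "w2 = matC G2 *v x2 + matD G2 *v v2"
    and v: "v1 = w2" "v2 = w1"
  shows "sysA (interconnection G1 G2) *v stack x1 x2 + sysB (interconnection G1 G2) *v stack d1 d2
      = stack (matA G1 *v x1 + matB G1 *v v1 + matE G1 *v d1)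
              (matA G2 *v x2 + matB G2 *v v2 + matE G2 *v d2)"
    and "sysC (interconnection G1 G2) *v stack x1 x2 + sysD (interconnection G1 G2) *v stack d1 d2
      = stack (matF G1 *v x1 + matK G1 *v v1 + matL G1 *v d1)
              (matF G2 *v x2 + matK G2 *v v2 + matL G2 *v d2)"
proof -
  define M where "M = matrix_inv (mat 1 - matD G2 ** matD G1)"
  have M: "M ** (mat 1 - matD G2 ** matD G1) = mat 1"
    using assms(1) unfolding M_def well_posed_iff_invertible invertible_def matrix_inv_def
    by (rule someI2_ex) simp
  have "v1 = matC G2 *v x2 + matD G2 *v (matC G1 *v x1 + matD G1 *v v1)"
    by (fold w1, fold v(2), unfold v(1), fact w2)
  then have "(mat 1 - matD G2 ** matD G1) *v v1 = matC G2 *v x2 + matD G2 *v (matC G1 *v x1)"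
    by (simp add: matrix_vector_mult_diff_rdistrib matrix_vector_mul_assoc [symmetric]
        matrix_vector_right_distrib diff_eq_eq add.assoc)
  then have "M *v (matC G2 *v x2 + matD G2 *v (matC G1 *v x1))
      = (M ** (mat 1 - matD G2 ** matD G1)) *v v1"
    by (simp only: matrix_vector_mul_assoc [symmetric])
  then have v1: "v1 = M *v (matC G2 *v x2 + matD G2 *v (matC G1 *v x1))"
    by (simp only: M matrix_vector_mul_lid)
  have v2: "v2 = matC G1 *v x1 + matD G1 *v (M *v (matC G2 *v x2 + matD G2 *v (matC G1 *v x1)))"
    by (unfold v(2) w1, fold v1, rule refl)
  note simps = interconnection_def Let_def M_def [symmetric] block_mult_stack stack_add
    matrix_vector_mult_add_rdistrib matrix_vector_mul_assoc [symmetric] matrix_vector_right_distrib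
    add_ac
  show "sysA (interconnection G1 G2) *v stack x1 x2 + sysB (interconnection G1 G2) *v stack d1 d2
      = stack (matA G1 *v x1 + matB G1 *v v1 + matE G1 *v d1)
              (matA G2 *v x2 + matB G2 *v v2 + matE G2 *v d2)"
    unfolding v1 v2 by (simp add: simps)
  show "sysC (interconnection G1 G2) *v stack x1 x2 + sysD (interconnection G1 G2) *v stack d1 d2
      = stack (matF G1 *v x1 + matK G1 *v v1 + matL G1 *v d1)
              (matF G2 *v x2 + matK G2 *v v2 + matL G2 *v d2)"
    unfolding v1 v2 by (simp add: simps)
qed

end

theory Submission
  imports Defs
begin

text \<open>Write \<open>f\<^sub>i\<close> for the quadratic form \<open>sext\<^sub>i(d\<^sub>i, z\<^sub>i) - 2 x\<^sub>i\<^sup>T P\<^sub>i (A\<^sub>i x\<^sub>i + B\<^sub>i v\<^sub>i + E\<^sub>i d\<^sub>i)\<close> and let \<open>T\<^sub>1\<close>, \<open>T\<^sub>2\<close> send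
  \<open>(x\<^sub>i, v\<^sub>i, d\<^sub>i)\<close> to \<open>(v\<^sub>1, w\<^sub>1)\<close> and \<open>(w\<^sub>2, v\<^sub>2)\<close>; both maps are onto because \<open>C\<^sub>1\<close>, \<open>C\<^sub>2\<close> have full row
  rank. The hypothesis says that \<open>f\<^sub>1(a) + f\<^sub>2(b) > 0\<close> for \<open>(a, b) \<noteq> 0\<close> with \<open>T\<^sub>1 a = T\<^sub>2 b\<close>. In particular
  \<open>f\<^sub>i\<close> is positive definite on the kernel of \<open>T\<^sub>i\<close>, so its minimum over the fibre of \<open>T\<^sub>i\<close> above \<open>y\<close>
  is attained and is a quadratic form \<open>g\<^sub>i(y)\<close> (a Schur complement). As \<open>g\<^sub>1 + g\<^sub>2 > 0\<close> away from \<open>0\<close>,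
  the form \<open>(g\<^sub>2 - g\<^sub>1)/2\<close> can serve as \<open>s1int\<close> and its negative,
  with the two arguments swapped, as \<open>s2int\<close>.\<close>

subsection \<open>Quadratic forms\<close>

text \<open>Stated through bilinear maps, without coordinates, so that it applies to product spaces
  such as the triples \<open>(x, v, d)\<close> and is stable under composition with linear maps.
  Matrices return only in \<open>quadratic_supply_iff\<close>.\<close>

definition quadratic_form :: "('a::real_vector \<Rightarrow> real) \<Rightarrow> bool" where
  "quadratic_form f \<longleftrightarrow> (\<exists>b. bilinear b \<and> f = (\<lambda>x. b x x))"

lemma bilinear_compose:
  assumes "bilinear b" "linear L" "linear M"
  shows "bilinear (\<lambda>x y. b (L x) (M y))"
  using assms by (auto simp: bilinear_def linear_iff)

lemma quadratic_form_symmetric: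
  assumes "quadratic_form f"
  obtains b where "bilinear b" "\<And>x y. b x y = b y x" "\<And>x. f x = b x x"
proof -
  obtain c where c: "bilinear c" "f = (\<lambda>x. c x x)"
    using assms by (auto simp: quadratic_form_def)
  show thesis
  proof (rule that)
    show "bilinear (\<lambda>x y. (c x y + c y x) / 2)"
      using c(1) by (auto simp: bilinear_def linear_iff field_simps)
  qed (use c(2) in auto)
qed

lemma quadratic_form_add:
  assumes "quadratic_form f" "quadratic_form g"
  shows "quadratic_form (\<lambda>x. f x + g x)"
proof -
  obtain b c where "bilinear b" "bilinear c" "f = (\<lambda>x. b x x)" "g = (\<lambda>x. c x x)"
    using assms by (auto simp: quadratic_form_def)
  then show ?thesis
    unfolding quadratic_form_def
    by (intro exI [of _ "\<lambda>x y. b x y + c x y"]) (auto simp: bilinear_def linear_iff algebra_simps)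
qed

lemma quadratic_form_cmul:
  assumes "quadratic_form f"
  shows "quadratic_form (\<lambda>x. k * f x)"
proof -
  obtain b where "bilinear b" "f = (\<lambda>x. b x x)"
    using assms by (auto simp: quadratic_form_def)
  then show ?thesis
    unfolding quadratic_form_def
    by (intro exI [of _ "\<lambda>x y. k * b x y"]) (auto simp: bilinear_def linear_iff algebra_simps)
qed

lemma quadratic_form_diff:
  assumes "quadratic_form f" "quadratic_form g"
  shows "quadratic_form (\<lambda>x. f x - g x)"
  using quadratic_form_add [OF assms(1) quadratic_form_cmul [OF assms(2), of "-1"]] by simp

lemma quadratic_form_compose:
  assumes "quadratic_form f" "linear L"
  shows "quadratic_form (\<lambda>x. f (L x))"
proof -
  obtain b where "bilinear b" "f = (\<lambda>x. b x x)"
    using assms(1) by (auto simp: quadratic_form_def)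
  then show ?thesis
    unfolding quadratic_form_def
    by (intro exI [of _ "\<lambda>x y. b (L x) (L y)"]) (simp add: bilinear_compose assms(2))
qed

lemma quadratic_form_inner:
  fixes L M :: "'a::real_vector \<Rightarrow> 'b::real_inner"
  assumes "linear L" "linear M"
  shows "quadratic_form (\<lambda>x. L x \<bullet> M x)"
  unfolding quadratic_form_def using assms
  by (intro exI [of _ "\<lambda>x y. L x \<bullet> M y"]) (auto simp: bilinear_def linear_iff inner_simps)

text \<open>The linear map \<open>S\<close> inverts \<open>T\<close> on the \<open>b\<close>-orthogonal complement \<open>U\<close> of the kernel, which \<open>T\<close>
  maps bijectively: \<open>U\<close> meets the kernel trivially, and it is large enough by counting dimensions.\<close>

lemma quadratic_form_fibre_min:
  fixes f :: "'a::euclidean_space \<Rightarrow> real" and T :: "'a \<Rightarrow> 'b::euclidean_space"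
  assumes f: "quadratic_form f" and T: "linear T" "surj T"
    and pos: "\<And>x. T x = 0 \<Longrightarrow> x \<noteq> 0 \<Longrightarrow> 0 < f x"
  obtains S where "linear S" "\<And>y. T (S y) = y" "\<And>x. f (S (T x)) \<le> f x"
proof -
  obtain b where b: "bilinear b" and sym: "\<And>x y. b x y = b y x" and fb: "\<And>x. f x = b x x"
    by (rule quadratic_form_symmetric [OF f]) blast
  define N where "N = {x. T x = 0}"
  define U where "U = {x. \<forall>n\<in>N. b n x = 0}"
  define F where "F n = adjoint (b n) 1" for n
  have N: "subspace N"
    unfolding N_def by (rule linear_subspace_kernel [OF T(1)])
  have U: "subspace U"
    using b by (auto simp: U_def subspace_def bilinear_radd bilinear_rmul bilinear_rzero)
  have F: "F n \<bullet> x = b n x" for n x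
  proof -
    have "linear (b n)"
      using b by (simp add: bilinear_def)
    then show ?thesis
      by (simp add: F_def inner_commute [of _ x] adjoint_works)
  qed
  have linF: "linear F"
    by (rule linearI; rule vector_eq_rdot [THEN iffD1])
       (auto simp: F inner_simps bilinear_ladd [OF b] bilinear_lmul [OF b])
  have UF: "U = {y \<in> UNIV. \<forall>x\<in>F ` N. orthogonal x y}"
    by (auto simp: U_def orthogonal_def F)
  \<comment> \<open>\<open>T\<close> is onto already on the Euclidean complement of
    \<open>N\<close>. Since \<open>F\<close> cannot raise the dimension of \<open>N\<close>, the
    space \<open>U\<close> is at least as large as that complement, hence has dimension at least
    that of the target.\<close>
  have "DIM('b) \<le> dim {y \<in> UNIV. \<forall>x\<in>N. orthogonal x y}"
  proof -
    have "y \<in> T ` {y \<in> UNIV. \<forall>x\<in>N. orthogonal x y}" for y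
    proof -
      obtain x where x: "y = T x"
        using T(2) by (metis surjD)
      have "span N = N"
        using N by (simp add: span_eq_iff)
      then obtain u w where uw: "u \<in> N" "\<And>w'. w' \<in> N \<Longrightarrow> orthogonal w w'" "x = u + w"
        using orthogonal_subspace_decomp_exists [of N x] by metis
      then have "y = T w"
        by (simp add: x N_def linear_add [OF T(1)])
      then show ?thesis
        using uw(2) by (auto simp: orthogonal_commute)
    qed
    then have "T ` {y \<in> UNIV. \<forall>x\<in>N. orthogonal x y} = UNIV"
      by blast
    then show ?thesis
      by (metis dim_UNIV dim_image_le T(1))
  qed
  moreover have "dim {y \<in> UNIV. \<forall>x\<in>N. orthogonal x y} + dim N = DIM('a)"
    using dim_subspace_orthogonal_to_vectors [OF N subspace_UNIV] by simp
  moreover have "dim U + dim (F ` N) = DIM('a)"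
    unfolding UF
    using dim_subspace_orthogonal_to_vectors [OF linear_subspace_image [OF linF N] subspace_UNIV] by simp
  moreover have "dim (F ` N) \<le> dim N"
    by (rule dim_image_le [OF linF])
  \<comment> \<open>A vector in both \<open>U\<close> and \<open>N\<close> is
    \<open>b\<close>-orthogonal to itself, which positivity on the kernel allows only for 0.\<close>
  moreover have "inj_on T U"
    unfolding linear_inj_on_iff_eq_0 [OF T(1) U]
  proof (intro ballI impI)
    fix x assume "x \<in> U" "T x = 0"
    then have "f x = 0"
      by (simp add: U_def N_def fb)
    then show "x = 0"
      using pos [OF \<open>T x = 0\<close>] by force
  qed
  then have "dim (T ` U) = dim U"
    using U dim_image_eq [OF T(1)] by (metis span_eq_iff)
  ultimately have "DIM('b) \<le> dim (T ` U)"
    by linarith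
  then have TU: "T ` U = UNIV"
    by (intro subspace_dim_equal linear_subspace_image T U) auto
  obtain S where S: "range S \<subseteq> U" "linear S" "\<And>y. T (S y) = y"
    using linear_exists_right_inverse_on [OF T(1) U] TU by auto
  show thesis
  proof (rule that [OF S(2,3)])
    fix x
    \<comment> \<open>Pythagoras for \<open>b\<close>: \<open>x\<close> splits into a kernel part
      \<open>n\<close> and a part in \<open>U\<close>, so \<open>f\<close> adds up over the
      two.\<close>
    define n where "n = x - S (T x)"
    have n: "n \<in> N"
      by (simp add: n_def N_def linear_diff [OF T(1)] S(3))
    then have "b n (S (T x)) = 0"
      using S(1) by (auto simp: U_def)
    moreover have "x = n + S (T x)"
      by (simp add: n_def)
    then have "f x = b (n + S (T x)) (n + S (T x))"
      by (simp add: fb)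
    ultimately have "f x = f n + f (S (T x))"
      using sym [of n "S (T x)"] by (simp add: fb bilinear_ladd [OF b] bilinear_radd [OF b])
    moreover have "0 \<le> f n"
      using pos [of n] n by (cases "n = 0") (auto simp: N_def fb bilinear_lzero [OF b])
    ultimately show "f (S (T x)) \<le> f x"
      by linarith
  qed
qed

text \<open>With gi = fi o Si the fibre minima, the bounds needed off the kernels follow from -g1 <
  q < g2 away from 0. There is room for such a q because \<open>S1 y\<close> and \<open>S2 y\<close>
  lie over the same point, so \<open>pos\<close> gives g1 + g2 > 0.\<close>

lemma quadratic_form_splitting:
  fixes T1 :: "'a::euclidean_space \<Rightarrow> 'c::euclidean_space" and T2 :: "'b::euclidean_space \<Rightarrow> 'c"
  assumes f: "quadratic_form f1" "quadratic_form f2"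
    and T1: "linear T1" "surj T1" and T2: "linear T2" "surj T2"
    and pos: "\<And>a b. T1 a = T2 b \<Longrightarrow> (a, b) \<noteq> (0, 0) \<Longrightarrow> 0 < f1 a + f2 b"
  obtains q where "quadratic_form q"
    "\<And>a. a \<noteq> 0 \<Longrightarrow> 0 < f1 a + q (T1 a)" "\<And>b. b \<noteq> 0 \<Longrightarrow> 0 < f2 b - q (T2 b)"
proof -
  have zero: "T1 0 = 0" "T2 0 = 0" "f1 0 = 0" "f2 0 = 0"
    using f by (auto simp: linear_0 T1 T2 quadratic_form_def bilinear_lzero)
  have pos1: "0 < f1 a" if "T1 a = 0" "a \<noteq> 0" for a
    using pos [of a 0] that zero by simp
  have pos2: "0 < f2 b" if "T2 b = 0" "b \<noteq> 0" for b
    using pos [of 0 b] that zero by simp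
  obtain S1 where S1: "linear S1" "\<And>y. T1 (S1 y) = y" "\<And>x. f1 (S1 (T1 x)) \<le> f1 x"
    by (rule quadratic_form_fibre_min [OF f(1) T1 pos1]) auto
  obtain S2 where S2: "linear S2" "\<And>y. T2 (S2 y) = y" "\<And>x. f2 (S2 (T2 x)) \<le> f2 x"
    by (rule quadratic_form_fibre_min [OF f(2) T2 pos2]) auto
  have sum: "0 < f1 (S1 y) + f2 (S2 y)" if "y \<noteq> 0" for y
  proof (rule pos)
    show "(S1 y, S2 y) \<noteq> (0, 0)"
      using that S1(2) [of y] zero by auto
  qed (simp add: S1 S2)
  \<comment> \<open>The midpoint between -g1(y) and g2(y), leaving the margin (g1(y) + g2(y))/2 on
    either side.\<close>
  define q where "q y = 1/2 * (f2 (S2 y) - f1 (S1 y))" for y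
  have q0: "q 0 = 0"
    by (simp add: q_def zero linear_0 S1(1) S2(1))
  show thesis
  proof (rule that)
    show "quadratic_form q"
      unfolding q_def
      by (intro quadratic_form_cmul quadratic_form_diff
          quadratic_form_compose [OF f(1) S1(1)] quadratic_form_compose [OF f(2) S2(1)])
  next
    fix a :: 'a assume "a \<noteq> 0"
    \<comment> \<open>Over the point 0 the bound \<open>sum\<close> is silent, but there q vanishes
      and \<open>f1\<close> is positive by itself.\<close>
    show "0 < f1 a + q (T1 a)"
    proof (cases "T1 a = 0")
      case True
      then show ?thesis
        using pos1 \<open>a \<noteq> 0\<close> q0 by simp
    next
      case False
      then show ?thesis
        using sum [of "T1 a"] S1(3) [of a] by (simp add: q_def field_simps)
    qed
  next
    fix b :: 'b assume "b \<noteq> 0"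
    show "0 < f2 b - q (T2 b)"
    proof (cases "T2 b = 0")
      case True
      then show ?thesis
        using pos2 \<open>b \<noteq> 0\<close> q0 by simp
    next
      case False
      then show ?thesis
        using sum [of "T2 b"] S2(3) [of b] by (simp add: q_def field_simps)
    qed
  qed
qed

subsection \<open>Matrix representations\<close>

lemma bilinear_matrix:
  fixes b :: "real^'m \<Rightarrow> real^'n \<Rightarrow> real"
  assumes b: "bilinear b"
  shows "b x y = x \<bullet> ((\<chi> i j. b (axis i 1) (axis j 1)) *v y)"
proof -
  have "b x y = b (\<Sum>i\<in>UNIV. x$i *\<^sub>R axis i 1) (\<Sum>j\<in>UNIV. y$j *\<^sub>R axis j 1)"
    using basis_expansion [of x] basis_expansion [of y] by (simp add: scalar_mult_eq_scaleR)
  also have "\<dots> = (\<Sum>i\<in>UNIV. \<Sum>j\<in>UNIV. x$i * (y$j * b (axis i 1) (axis j 1)))"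
    by (simp add: bilinear_sum [OF b] sum.cartesian_product bilinear_lmul [OF b] bilinear_rmul [OF b]
        mult.left_commute)
  also have "\<dots> = x \<bullet> ((\<chi> i j. b (axis i 1) (axis j 1)) *v y)"
    by (simp add: inner_vec_def matrix_vector_mult_def sum_distrib_left mult_ac)
  finally show ?thesis .
qed

lemma inner_stack:
  fixes x x' :: "real^'m" and y y' :: "real^'n"
  shows "stack x y \<bullet> stack x' y' = x \<bullet> x' + y \<bullet> y'"
  by (simp add: inner_vec_def stack_def sum_UNIV_Plus)

lemma inner_matrix_transpose: "x \<bullet> (transpose A *v y) = (A *v x) \<bullet> y"
  for A :: "real^'m^'n"
  by (metis dot_lmul_matrix vector_transpose_matrix)

lemma linear_Pair_fun: "linear f \<Longrightarrow> linear g \<Longrightarrow> linear (\<lambda>x. (f x, g x))"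
  by (auto simp: linear_iff)

lemma linear_stack:
  "linear (\<lambda>p. stack (fst p) (snd p) :: real^('m::finite + 'n::finite))"
  by (auto simp: linear_iff stack_def vec_eq_iff split: sum.split)

text \<open>The bridge between block matrices and coordinate-free forms. For the converse, the
  blocks are the values of a symmetric bilinear map on basis vectors of the two factors.\<close>

lemma quadratic_supply_iff:
  "quadratic_supply s \<longleftrightarrow> quadratic_form (\<lambda>p. s (fst p) (snd p))"
proof
  assume "quadratic_supply s"
  then obtain M where "s = (\<lambda>d z. stack d z \<bullet> (M *v stack d z))"
    unfolding quadratic_supply_def by blast
  then show "quadratic_form (\<lambda>p. s (fst p) (snd p))"
    using linear_compose [OF linear_stack matrix_vector_mul_linear [of M]]
    by (auto intro!: quadratic_form_inner linear_stack simp: o_def)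
next
  assume "quadratic_form (\<lambda>p. s (fst p) (snd p))"
  then obtain b where b: "bilinear b" and sym: "\<And>x y. b x y = b y x"
    and sb: "\<And>p. s (fst p) (snd p) = b p p"
    by (rule quadratic_form_symmetric) blast
  have lin: "linear (\<lambda>d. (d, 0))" "linear (\<lambda>z. (0, z))"
    by (auto simp: linear_iff)
  define Q where "Q = (\<chi> i j. b (axis i 1, 0) (axis j 1, 0))"
  define S where "S = (\<chi> i j. b (axis i 1, 0) (0, axis j 1))"
  define R where "R = (\<chi> i j. b (0, axis i 1) (0, axis j 1))"
  have "s d z = stack d z \<bullet> (block Q S (transpose S) R *v stack d z)" for d z
  proof -
    have "s d z = b ((d, 0) + (0, z)) ((d, 0) + (0, z))"
      using sb [of "(d, z)"] by simp
    also have "\<dots> = b (d, 0) (d, 0) + 2 * b (d, 0) (0, z) + b (0, z) (0, z)"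
      using sym [of "(d, 0)" "(0, z)"]
      by (simp only: bilinear_ladd [OF b] bilinear_radd [OF b])
    also have "b (d, 0) (d, 0) = d \<bullet> (Q *v d)"
      unfolding Q_def by (rule bilinear_matrix [OF bilinear_compose [OF b lin(1) lin(1)]])
    also have "b (d, 0) (0, z) = d \<bullet> (S *v z)"
      unfolding S_def by (rule bilinear_matrix [OF bilinear_compose [OF b lin]])
    also have "b (0, z) (0, z) = z \<bullet> (R *v z)"
      unfolding R_def by (rule bilinear_matrix [OF bilinear_compose [OF b lin(2) lin(2)]])
    \<comment> \<open>The lower left block contributes the same amount as \<open>S\<close>, which
      accounts for the factor 2 of the mixed term.\<close>
    finally show ?thesis
      by (simp add: block_mult_stack inner_stack inner_add_right 
          inner_matrix_transpose [of z S d] inner_commute [of "S *v z" d]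
          del: transpose_matrix_vector)
  qed
  moreover have "transpose Q = Q" "transpose R = R"
    by (auto simp: Q_def R_def transpose_def vec_eq_iff sym)
  ultimately show "quadratic_supply s"
    unfolding quadratic_supply_def by blast
qed

lemma symmetric_matrix_polarization:
  fixes P :: "real^'n^'n"
  assumes "transpose P = P"
  shows "2 * (x \<bullet> (P *v y)) = (x + y) \<bullet> (P *v (x + y)) - x \<bullet> (P *v x) - y \<bullet> (P *v y)"
proof -
  have "y \<bullet> (P *v x) = x \<bullet> (P *v y)"
    using inner_matrix_transpose [of y P x] assms by (simp add: inner_commute)
  then show ?thesis
    by (simp add: matrix_vector_right_distrib inner_simps)
qed

text \<open>The definition yields some symmetric matrix of \<open>V\<close>. By polarization any
  other symmetric matrix of \<open>V\<close> gives the same products, so a block diagonal one may be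
  used later.\<close>

lemma strictly_dissipativeD:
  assumes "strictly_dissipative G s V" "transpose P = P" "\<And>x. V x = x \<bullet> (P *v x)" "(x, d) \<noteq> (0, 0)"
  shows "2 * (x \<bullet> (P *v (sysA G *v x + sysB G *v d))) < s d (sysC G *v x + sysD G *v d)"
proof -
  obtain P' where P': "transpose P' = P'" "V = (\<lambda>x. x \<bullet> (P' *v x))"
    "2 * (x \<bullet> (P' *v (sysA G *v x + sysB G *v d))) < s d (sysC G *v x + sysD G *v d)"
    using assms(1,4) unfolding strictly_dissipative_def by blast
  have "2 * (x \<bullet> (P' *v y)) = 2 * (x \<bullet> (P *v y))" for y
    unfolding symmetric_matrix_polarization [OF P'(1)] symmetric_matrix_polarization [OF assms(2)]
    using P'(2) assms(3) by metis
  then show ?thesis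
    using P'(3) by simp
qed

subsection \<open>Interconnected systems\<close>

definition supply_surplus ::
  "('n::finite, 'v::finite, 'w::finite, 'd::finite, 'z::finite) subsystem
   \<Rightarrow> (real^'d \<Rightarrow> real^'z \<Rightarrow> real) \<Rightarrow> real^'n^'n \<Rightarrow> (real^'n) \<times> (real^'v) \<times> (real^'d) \<Rightarrow> real" where
  "supply_surplus G s P = (\<lambda>(x, v, d).
     s d (matF G *v x + matK G *v v + matL G *v d)
     - 2 * (x \<bullet> (P *v (matA G *v x + matB G *v v + matE G *v d))))"

lemma linear_mult_fun: "linear f \<Longrightarrow> linear (\<lambda>x. A *v f x)" for A :: "real^'m^'n"
  using linear_compose [of f "(*v) A"] by (simp add: o_def)

lemma linear_components:
  "linear (\<lambda>a. fst (snd a))" "linear (\<lambda>a. snd (snd a))"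
  by (auto simp: linear_iff)

lemma quadratic_form_surplus:
  assumes "quadratic_supply s"
  shows "quadratic_form (supply_surplus G s P)"
proof -
  let ?z = "\<lambda>a. matF G *v fst a + matK G *v fst (snd a) + matL G *v snd (snd a)"
  let ?x = "\<lambda>a. P *v (matA G *v fst a + matB G *v fst (snd a) + matE G *v snd (snd a))"
  have "quadratic_form (\<lambda>a. s (fst (snd (snd a), ?z a)) (snd (snd (snd a), ?z a)))"
    by (rule quadratic_form_compose [OF assms [unfolded quadratic_supply_iff]])
       (intro linear_Pair_fun linear_compose_add linear_mult_fun linear_components linear_fst)
  moreover have "quadratic_form (\<lambda>a. 2 * (fst a \<bullet> ?x a))"
    by (intro quadratic_form_cmul quadratic_form_inner linear_compose_add linear_mult_fun
        linear_components linear_fst)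
  ultimately show ?thesis
    unfolding supply_surplus_def case_prod_beta by (simp add: quadratic_form_diff)
qed

lemma strictly_dissipative_open_loop:
  fixes G :: "('n::finite, 'v::finite, 'w::finite, 'd::finite, 'z::finite) subsystem"
  assumes P: "transpose P = P" and V: "V = (\<lambda>x. x \<bullet> (P *v x))"
    and s: "quadratic_supply sext" "quadratic_supply sint"
    and pos: "\<And>x v d. (x, v, d) \<noteq> 0 \<Longrightarrow>
      0 < supply_surplus G sext P (x, v, d) + sint v (matC G *v x + matD G *v v)"
  shows "strictly_dissipative (open_loop G)
    (\<lambda>u y. sext (lower u) (lower y) + sint (upper u) (upper y)) V"
  unfolding strictly_dissipative_def
proof (intro conjI exI [of _ P] P V allI impI)
  have "linear (\<lambda>p. (lower (fst p), lower (snd p)))" "linear (\<lambda>p. (upper (fst p), upper (snd p)))"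
    by (auto simp: linear_iff upper_def lower_def vec_eq_iff)
  from quadratic_form_add [OF quadratic_form_compose [OF s(1) [unfolded quadratic_supply_iff] this(1)]
      quadratic_form_compose [OF s(2) [unfolded quadratic_supply_iff] this(2)]]
  show "quadratic_supply (\<lambda>u y. sext (lower u) (lower y) + sint (upper u) (upper y))"
    by (simp add: quadratic_supply_iff)
next
  fix x :: "real^'n" and u assume "(x, u) \<noteq> (0, 0 :: real^('v + 'd))"
  moreover obtain v d where u: "u = stack v d"
    by (metis stack_upper_lower)
  moreover have "stack 0 0 = (0 :: real^('v + 'd))"
    by (auto simp: stack_def vec_eq_iff split: sum.split)
  ultimately have "(x, v, d) \<noteq> 0"
    by (auto simp: zero_prod_def)
  from pos [OF this]
  show "2 * (x \<bullet> (P *v (sysA (open_loop G) *v x + sysB (open_loop G) *v u)))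
    < sext (lower u) (lower (sysC (open_loop G) *v x + sysD (open_loop G) *v u))
      + sint (upper u) (upper (sysC (open_loop G) *v x + sysD (open_loop G) *v u))"
    by (simp add: u open_loop_def supply_surplus_def hblock_mult_stack block_mult_stack stack_mult
        stack_add add_ac)
qed

text \<open>Here full row rank enters: the state alone can compensate for \<open>v\<close> and steer
  the output to any value, so \<open>v\<close> and \<open>w\<close> can be prescribed
  independently.\<close>

lemma surj_graph_output:
  fixes C :: "real^'n^'q" and D :: "real^'p^'q"
  assumes "rank C = CARD('q)"
  obtains x where "C *v x + D *v v = w"
proof -
  obtain x where "w - D *v v = C *v x"
    using assms unfolding full_rank_surjective by (metis surjD)
  then show thesis
    by (intro that [of x]) (simp add: algebra_simps)
qed

text \<open>Under the coupling equations the two subsystems move exactly as the interconnection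
  does, so its dissipation inequality is the sum of the two surpluses being positive.\<close>

lemma interconnection_surplus_pos:
  assumes wp: "well_posed G1 G2"
    and P1: "transpose P1 = P1" "V1 = (\<lambda>x. x \<bullet> (P1 *v x))"
    and P2: "transpose P2 = P2" "V2 = (\<lambda>x. x \<bullet> (P2 *v x))"
    and diss: "strictly_dissipative (interconnection G1 G2)
           (\<lambda>d z. s1 (upper d) (upper z) + s2 (lower d) (lower z))
           (\<lambda>x. V1 (upper x) + V2 (lower x))"
    and v1: "v1 = matC G2 *v x2 + matD G2 *v v2" and v2: "v2 = matC G1 *v x1 + matD G1 *v v1"
    and nz: "((x1, v1, d1), (x2, v2, d2)) \<noteq> 0"
  shows "0 < supply_surplus G1 s1 P1 (x1, v1, d1) + supply_surplus G2 s2 P2 (x2, v2, d2)"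
proof -
  \<comment> \<open>Dissipativity excludes only zero state and external input, whereas
    \<open>nz\<close> might hold through \<open>v1\<close> or \<open>v2\<close> alone.
    Well-posedness rules this out: zero states force zero coupling signals.\<close>
  have "(stack x1 x2, stack d1 d2) \<noteq> (0, 0)"
  proof
    assume "(stack x1 x2, stack d1 d2) = (0, 0)"
    then have "stack x1 x2 = 0" "stack d1 d2 = 0"
      by simp_all
    then have 0: "x1 = 0" "x2 = 0" "d1 = 0" "d2 = 0"
      by (auto simp: stack_def vec_eq_iff split: sum.splits)
    have "\<exists>!(v1, v2). v1 = matD G2 *v v2 \<and> v2 = matD G1 *v v1"
      using wp [unfolded well_posed_def, rule_format, of 0 0] by simp
    moreover have "v1 = matD G2 *v v2 \<and> v2 = matD G1 *v v1"
      using v1 v2 unfolding 0 matrix_vector_mult_0_right add_0 by blast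
    moreover have "0 = matD G2 *v 0 \<and> 0 = matD G1 *v 0"
      by simp
    ultimately have "(v1, v2) = (0, 0)"
      unfolding Ex1_def by (metis (mono_tags, lifting) case_prod_conv)
    then show False
      using nz 0 by (simp add: zero_prod_def)
  qed
  moreover define P where "P = block P1 0 0 P2"
  have quad: "stack x x' \<bullet> (P *v stack y y') = x \<bullet> (P1 *v y) + x' \<bullet> (P2 *v y')" for x y x' y'
    by (simp add: P_def block_mult_stack inner_stack)
  have "transpose P = P"
    using P1(1) P2(1)
    by (auto simp: P_def transpose_def block_def hblock_def stack_def vec_eq_iff split: sum.split)
  moreover have "V1 (upper x) + V2 (lower x) = x \<bullet> (P *v x)" for x
    using quad [of "upper x" "lower x" "upper x" "lower x"] by (simp add: P1(2) P2(2))
  ultimately have "2 * (stack x1 x2 \<bullet> (P *v (sysA (interconnection G1 G2) *v stack x1 x2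
        + sysB (interconnection G1 G2) *v stack d1 d2)))
    < s1 (upper (stack d1 d2)) (upper (sysC (interconnection G1 G2) *v stack x1 x2
        + sysD (interconnection G1 G2) *v stack d1 d2))
      + s2 (lower (stack d1 d2)) (lower (sysC (interconnection G1 G2) *v stack x1 x2
        + sysD (interconnection G1 G2) *v stack d1 d2))"
    using strictly_dissipativeD [OF diss] by blast
  then show ?thesis
    unfolding interconnection_correct [OF wp refl refl v1 v2] quad upper_stack lower_stack
    by (simp add: supply_surplus_def)
qed

theorem theorem3p1:
  fixes G1 :: "('n1::finite, 'p::finite, 'q::finite, 'd1::finite, 'z1::finite) subsystem"
    and G2 :: "('n2::finite, 'q, 'p, 'd2::finite, 'z2::finite) subsystem"
    and s1ext :: "real^'d1 \<Rightarrow> real^'z1 \<Rightarrow> real"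
    and s2ext :: "real^'d2 \<Rightarrow> real^'z2 \<Rightarrow> real"
    and V1 :: "real^'n1 \<Rightarrow> real"
    and V2 :: "real^'n2 \<Rightarrow> real"
  assumes "rank (matC G1) = CARD('q)"
    and "rank (matC G2) = CARD('p)"
    and "well_posed G1 G2"
    and "quadratic_supply s1ext"
    and "quadratic_supply s2ext"
    and "quadratic_storage V1"
    and "quadratic_storage V2"
    and "strictly_dissipative (interconnection G1 G2)
           (\<lambda>d z. s1ext (upper d) (upper z) + s2ext (lower d) (lower z))
           (\<lambda>x. V1 (upper x) + V2 (lower x))"
  shows "\<exists>(s1int :: real^'p \<Rightarrow> real^'q \<Rightarrow> real) (s2int :: real^'q \<Rightarrow> real^'p \<Rightarrow> real).
           quadratic_supply s1int \<and> quadratic_supply s2int \<and>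
           (\<forall>v1 w1 v2 w2. v1 = w2 \<and> v2 = w1 \<longrightarrow> s1int v1 w1 + s2int v2 w2 = 0) \<and>
           strictly_dissipative (open_loop G1)
             (\<lambda>u y. s1ext (lower u) (lower y) + s1int (upper u) (upper y)) V1 \<and>
           strictly_dissipative (open_loop G2)
             (\<lambda>u y. s2ext (lower u) (lower y) + s2int (upper u) (upper y)) V2"
proof -
  obtain P1 P2 where P1: "transpose P1 = P1" "V1 = (\<lambda>x. x \<bullet> (P1 *v x))"
    and P2: "transpose P2 = P2" "V2 = (\<lambda>x. x \<bullet> (P2 *v x))"
    using assms(6,7) unfolding quadratic_storage_def by blast
  define T1 where "T1 = (\<lambda>a :: (real^'n1) \<times> (real^'p) \<times> (real^'d1).
    (fst (snd a), matC G1 *v fst a + matD G1 *v fst (snd a)))"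
  \<comment> \<open>Output first, so that \<open>T1 a = T2 b\<close> says v1 = w2 and w1 =
    v2.\<close>
  define T2 where "T2 = (\<lambda>a :: (real^'n2) \<times> (real^'q) \<times> (real^'d2).
    (matC G2 *v fst a + matD G2 *v fst (snd a), fst (snd a)))"
  have lin: "linear T1" "linear T2"
    unfolding T1_def T2_def
    by (intro linear_Pair_fun linear_compose_add linear_mult_fun linear_components linear_fst)+
  have "\<exists>a. y = T1 a" for y
  proof -
    obtain x where "matC G1 *v x + matD G1 *v fst y = snd y"
      by (rule surj_graph_output [OF assms(1)])
    then show ?thesis
      by (intro exI [of _ "(x, fst y, 0)"]) (simp add: T1_def)
  qed
  moreover have "\<exists>a. y = T2 a" for y
  proof -
    obtain x where "matC G2 *v x + matD G2 *v snd y = fst y"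
      by (rule surj_graph_output [OF assms(2)])
    then show ?thesis
      by (intro exI [of _ "(x, snd y, 0)"]) (simp add: T2_def)
  qed
  ultimately have surj: "surj T1" "surj T2"
    unfolding surj_def by blast+
  have pos: "0 < supply_surplus G1 s1ext P1 a + supply_surplus G2 s2ext P2 b"
    if eq: "T1 a = T2 b" and nz: "(a, b) \<noteq> (0, 0)" for a b
  proof -
    obtain x1 v1 d1 where a: "a = (x1, v1, d1)"
      by (cases a)
    obtain x2 v2 d2 where b: "b = (x2, v2, d2)"
      by (cases b)
    show ?thesis
      unfolding a b
      by (rule interconnection_surplus_pos [OF assms(3) P1 P2 assms(8)])
         (use eq nz in \<open>auto simp: a b T1_def T2_def zero_prod_def\<close>)
  qed
  obtain q where q: "quadratic_form q"
    "\<And>a. a \<noteq> 0 \<Longrightarrow> 0 < supply_surplus G1 s1ext P1 a + q (T1 a)"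
    "\<And>b. b \<noteq> 0 \<Longrightarrow> 0 < supply_surplus G2 s2ext P2 b - q (T2 b)"
    by (rule quadratic_form_splitting [OF quadratic_form_surplus [OF assms(4)]
          quadratic_form_surplus [OF assms(5)] lin(1) surj(1) lin(2) surj(2) pos]) auto
  have s1: "quadratic_supply (\<lambda>v w. q (v, w))"
    unfolding quadratic_supply_iff using q(1) by simp
  \<comment> \<open>The swap undoes the reversed order of \<open>T2\<close>. Under the coupling both
    internal supplies evaluate \<open>q\<close> at the same point, with opposite signs.\<close>
  have "linear (\<lambda>p :: (real^'q) \<times> (real^'p). (snd p, fst p))"
    by (auto simp: linear_iff)
  from quadratic_form_cmul [OF quadratic_form_compose [OF q(1) this], of "-1"]
  have s2: "quadratic_supply (\<lambda>v w. - q (w, v))"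
    by (simp add: quadratic_supply_iff)
  show ?thesis
  proof (intro exI [of _ "\<lambda>v w. q (v, w)"] exI [of _ "\<lambda>v w. - q (w, v)"] conjI s1 s2)
    show "strictly_dissipative (open_loop G1)
        (\<lambda>u y. s1ext (lower u) (lower y) + q (upper u, upper y)) V1"
      by (rule strictly_dissipative_open_loop [OF P1 assms(4) s1])
         (use q(2) in \<open>fastforce simp: T1_def\<close>)
    show "strictly_dissipative (open_loop G2)
        (\<lambda>u y. s2ext (lower u) (lower y) + - q (upper y, upper u)) V2"
      by (rule strictly_dissipative_open_loop [OF P2 assms(5) s2])
         (use q(3) in \<open>fastforce simp: T2_def\<close>)
  qed simp
qed

end
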